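(* Let $G$ be a connected $\{\text{butterfly},\text{hammer}\}$-free graph with $\omega(G)\neq 2$. Then: (i) There exists a partition $V(G)=X_1\cup X_2\cup X_3\cup X_4\cup X_5$ (into pairwise disjoint sets, some possibly empty) such that $X_1$ is a dominating set of $G$, $\langle X_1\rangle$ is an $\omega(G)$-partite graph with $\omega(\langle X_1\rangle)=\omega(G)$, each of $X_2$, $X_3$, $X_4$ is an independent set, and $\langle X_1\cup X_5\rangle$ is $2K_2$-free. (ii) $\chi(G)\leq \binom{\omega(G)+1}{2}$.
   Context: All graphs are simple, finite and undirected. $\omega(G)$ is the clique number and $\chi(G)$ the chromatic number of $G$. For $S\subseteq V(G)$, $\langle S\rangle$ denotes the subgraph induced by $S$. For a family $\mathcal{F}$ of graphs, $G$ is $\mathcal{F}$-free if it has no induced subgraph isomorphic to a member of $\mathcal{F}$. The butterfly is the graph on five vertices consisting of two triangles sharing exactly one vertex (with no other edges). The hammer is the graph on five vertices $a,b,c,d,e$ with edges $ab,bc,ac,cd,de$. $2K_2$ is the disjoint union of two copies of $K_2$. A set $S\subseteq V(G)$ is dominating if every vertex of $V(G)\setminus S$ has a neighbor in $S$. A graph is $k$-partite if its vertex set can be partitioned into $k$ independent sets. *)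

theory Defs
  imports
    "Graph_Theory.Digraph_Isomorphism"
    "Graph_Theory.Kuratowski"
    "HOL-Library.Disjoint_Sets"
begin

text \<open>
  A finite simple undirected graph is a digraph satisfying the locale \<open>graph\<close>: each edge is
  represented by its two opposite arcs. The proposition \<open>u \<rightarrow>\<^bsub>G\<^esub> v\<close> is adjacency; its library
  name \<open>dominates\<close> has nothing to do with dominating sets.
\<close>

definition independent_set :: "('a,'b) pre_digraph \<Rightarrow> 'a set \<Rightarrow> bool" where
  "independent_set G S \<longleftrightarrow> S \<subseteq> verts G \<and> (\<forall>u\<in>S. \<forall>v\<in>S. \<not> u \<rightarrow>\<^bsub>G\<^esub> v)"

definition dominating_set :: "('a,'b) pre_digraph \<Rightarrow> 'a set \<Rightarrow> bool" where
  "dominating_set G S \<longleftrightarrow> S \<subseteq> verts G \<and> (\<forall>v\<in>verts G - S. \<exists>u\<in>S. v \<rightarrow>\<^bsub>G\<^esub> u)"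

text \<open>For a finite graph the set below is finite, and it contains 0 (the null graph).\<close>

definition clique_number :: "('a,'b) pre_digraph \<Rightarrow> nat" where
  "clique_number G = Max {n. \<exists>H. subgraph H G \<and> K\<^bsub>n\<^esub> H}"

definition proper_coloring :: "('a,'b) pre_digraph \<Rightarrow> nat \<Rightarrow> ('a \<Rightarrow> nat) \<Rightarrow> bool" where
  "proper_coloring G k c \<longleftrightarrow>
     (\<forall>v\<in>verts G. c v < k) \<and> (\<forall>u\<in>verts G. \<forall>v\<in>verts G. u \<rightarrow>\<^bsub>G\<^esub> v \<longrightarrow> c u \<noteq> c v)"

definition chromatic_number :: "('a,'b) pre_digraph \<Rightarrow> nat" where
  "chromatic_number G = (LEAST k. \<exists>c. proper_coloring G k c)"

text \<open>As usual for \<open>k\<close>-partite graphs, some of the parts may be empty.\<close>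

definition k_partite :: "nat \<Rightarrow> ('a,'b) pre_digraph \<Rightarrow> bool" where
  "k_partite k G \<longleftrightarrow> (\<exists>P :: nat \<Rightarrow> 'a set.
     verts G = (\<Union>i<k. P i) \<and> disjoint_family_on P {..<k} \<and> (\<forall>i<k. independent_set G (P i)))"

definition induced_free :: "('c,'d) pre_digraph set \<Rightarrow> ('a,'b) pre_digraph \<Rightarrow> bool" where
  "induced_free F G \<longleftrightarrow> \<not> (\<exists>H\<in>F. \<exists>K. induced_subgraph K G \<and> digraph_iso K H)"

definition graph_of_edges :: "'a set \<Rightarrow> ('a \<times> 'a) set \<Rightarrow> ('a, 'a \<times> 'a) pre_digraph" where
  "graph_of_edges V E = with_proj \<lparr> pverts = V, parcs = E \<union> E\<inverse> \<rparr>"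

definition butterfly :: "(nat, nat \<times> nat) pre_digraph" where
  "butterfly = graph_of_edges {0,1,2,3,4} {(0,1), (1,2), (0,2), (2,3), (3,4), (2,4)}"

definition hammer :: "(nat, nat \<times> nat) pre_digraph" where
  "hammer = graph_of_edges {0,1,2,3,4} {(0,1), (1,2), (0,2), (2,3), (3,4)}"

definition two_K2 :: "(nat, nat \<times> nat) pre_digraph" where
  "two_K2 = graph_of_edges {0,1,2,3} {(0,1), (2,3)}"

end

theory Submission
  imports Defs
begin

text \<open>
  Fix a maximum clique \<open>K\<close>, with at least three vertices, and let \<open>M y\<close> be the set of its vertices
  not adjacent to \<open>y\<close>; it is never empty. If \<open>M y = M z = {v}\<close> then \<open>y, z\<close> are not adjacent, by
  maximality of \<open>K\<close>. If \<open>M y \<inter> M z\<close> has two elements \<open>i, j\<close> then \<open>y, z\<close> are not adjacent either: when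
  one of them, say \<open>y\<close>, has a neighbour \<open>c\<close> in \<open>K\<close>, the triangle \<open>i, j, c\<close> with the path \<open>c, y, z\<close> is a
  hammer or a butterfly; otherwise such a pattern arises from the path \<open>x, y, z\<close>, where \<open>x\<close> is a
  neighbour of \<open>y\<close> joined to at least two vertices of \<open>K\<close>. Hence the subsets of \<open>K\<close> of size one or two
  suffice as colours.

  For the partition take a triangle \<open>T = {i, j, l} \<subseteq> K\<close>. The vertices missing two given elements of
  \<open>T\<close> form three independent sets; what remains misses at most one element of \<open>T\<close>, is
  \<open>2K\<^sub>2\<close>-free, and contains the dominating set \<open>X\<^sub>1\<close> of all \<open>y\<close> with \<open>card (M y) = 1\<close>.
\<close>

section \<open>Induced copies of a graph given by its edges\<close>

text \<open>An isomorphism amounts to an adjacency table on labels. The inverse of \<open>f\<close>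
  maps the vertices, and an arc goes to the pair of labels of its ends, injectively because
  \<open>G\<close> has no parallel arcs.\<close>

lemma (in graph) digraph_iso_graph_of_edgesI:
  assumes inj: "inj_on f V" and sub: "f ` V \<subseteq> verts G"
    and EV: "E \<subseteq> V \<times> V"
    and adj: "\<And>x y. \<lbrakk>x \<in> V; y \<in> V\<rbrakk> \<Longrightarrow> f x \<rightarrow> f y \<longleftrightarrow> (x, y) \<in> E \<union> E\<inverse>"
  shows "digraph_iso (G \<restriction> f ` V) (graph_of_edges V E)"
proof -
  let ?K = "G \<restriction> f ` V"
  let ?g = "inv_into V f"
  let ?h = "\<lparr> iso_verts = ?g, iso_arcs = (\<lambda>e. (?g (tail G e), ?g (head G e))),
    iso_head = snd, iso_tail = fst \<rparr>"
  have g: "?g (f x) = x" if "x \<in> V" for x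
    using inj that by simp
  have inj_g: "inj_on ?g (f ` V)"
    by (simp add: inj_on_inv_into)
  have "inj_on (iso_arcs ?h) (arcs ?K)"
  proof (rule inj_onI)
    fix e e' assume e: "e \<in> arcs ?K" "e' \<in> arcs ?K" "iso_arcs ?h e = iso_arcs ?h e'"
    then have "tail G e = tail G e'" "head G e = head G e'"
      using inj_g by (auto dest: inj_onD)
    then show "e = e'"
      using e no_multi_arcs[of e e'] by (simp add: arc_to_ends_def)
  qed
  then have iso: "pre_digraph.digraph_isomorphism ?K ?h"
    using sub inj_g by (simp add: pre_digraph.digraph_isomorphism_def wellformed_induce_subgraph)
  have "(\<lambda>e. (?g (tail G e), ?g (head G e))) ` arcs ?K = E \<union> E\<inverse>" (is "?L = ?R")
  proof (intro equalityI subsetI)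
    fix z assume "z \<in> ?L"
    then obtain e x y where e: "e \<in> arcs G" "tail G e = f x" "head G e = f y" "x \<in> V" "y \<in> V"
      "z = (?g (tail G e), ?g (head G e))"
      by auto
    then have "f x \<rightarrow> f y"
      by (force simp: arcs_ends_conv)
    with e show "z \<in> ?R"
      using adj[of x y] g by simp
  next
    fix z assume z: "z \<in> ?R"
    obtain x y where xy: "z = (x, y)" by force
    with z EV have V: "x \<in> V" "y \<in> V" by auto
    then have "f x \<rightarrow> f y" using adj z xy by blast
    then obtain e where "e \<in> arcs G" "tail G e = f x" "head G e = f y"
      by blast
    with V xy g show "z \<in> ?L" by (force intro!: image_eqI[of _ _ e])
  qed
  moreover have "?g ` f ` V = V"
    using g by force
  ultimately have "graph_of_edges V E = app_iso ?h ?K"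
    by (simp add: graph_of_edges_def with_proj_def app_iso_def)
  with iso show ?thesis
    unfolding digraph_iso_def by blast
qed

text \<open>The labelling is the inverse of the vertex map of the isomorphism. Since
  \<open>K\<close> is induced, it contains every arc of \<open>G\<close> between its vertices, so
  non-adjacency transfers as well.\<close>

lemma (in graph) digraph_iso_graph_of_edgesD:
  assumes ind: "induced_subgraph K G" and iso: "digraph_iso K (graph_of_edges V E)"
  obtains f where "f ` V = verts K"
    "\<And>x y. \<lbrakk>x \<in> V; y \<in> V\<rbrakk> \<Longrightarrow> f x \<rightarrow> f y \<longleftrightarrow> (x, y) \<in> E \<union> E\<inverse>"
proof -
  obtain h where h: "pre_digraph.digraph_isomorphism K h" and eq: "graph_of_edges V E = app_iso h K"
    using iso unfolding digraph_iso_def by blast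
  have vV: "iso_verts h ` verts K = V" and aE: "iso_arcs h ` arcs K = E \<union> E\<inverse>"
    and "iso_tail h = fst" and "iso_head h = snd"
    using eq by (simp_all add: graph_of_edges_def with_proj_def app_iso_def)
  then have arc: "iso_arcs h e = (iso_verts h (tail G e), iso_verts h (head G e))"
    if "e \<in> arcs K" for e
    using h that ind
    by (auto simp: pre_digraph.digraph_isomorphism_def induced_subgraph_def subgraph_def
        compatible_def prod_eq_iff)
  have inj: "inj_on (iso_verts h) (verts K)"
    using h by (simp add: pre_digraph.digraph_isomorphism_def)
  let ?f = "inv_into (verts K) (iso_verts h)"
  have f: "?f x \<in> verts K" "iso_verts h (?f x) = x" if "x \<in> V" for x
    using that vV by (auto simp: inv_into_into f_inv_into_f)
  have arcsK: "arcs K = {e \<in> arcs G. tail G e \<in> verts K \<and> head G e \<in> verts K}"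
    using ind by (simp add: induced_subgraph_def)
  have adj: "?f x \<rightarrow> ?f y \<longleftrightarrow> (x, y) \<in> E \<union> E\<inverse>" if V: "x \<in> V" "y \<in> V" for x y
  proof
    assume "?f x \<rightarrow> ?f y"
    then obtain e where e: "e \<in> arcs G" "tail G e = ?f x" "head G e = ?f y"
      by blast
    then have "e \<in> arcs K"
      using arcsK f V by simp
    then have "iso_arcs h e \<in> E \<union> E\<inverse>"
      using aE by blast
    then show "(x, y) \<in> E \<union> E\<inverse>"
      using arc[OF \<open>e \<in> arcs K\<close>] e f V by simp
  next
    assume "(x, y) \<in> E \<union> E\<inverse>"
    then obtain e where e: "e \<in> arcs K" "iso_arcs h e = (x, y)"
      using aE by (metis imageE)
    then have "tail G e = ?f x" "head G e = ?f y"
      using arc[OF e(1)] arcsK inv_into_f_f[OF inj] by auto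
    then show "?f x \<rightarrow> ?f y"
      using e arcsK by (force simp: arcs_ends_conv)
  qed
  have "?f ` V = verts K"
    using vV inj by force
  then show thesis
    using adj that by blast
qed

section \<open>Adjacency and the forbidden patterns\<close>

lemma (in graph) adj_commute: "u \<rightarrow> v \<longleftrightarrow> v \<rightarrow> u"
  using graph_symmetric by blast

lemma (in graph) adj_verts: "u \<rightarrow> v \<Longrightarrow> u \<in> verts G \<and> v \<in> verts G"
  by (auto simp: arcs_ends_conv)

lemma (in graph) adj_irrefl: "\<not> u \<rightarrow> u"
  using adj_not_same by blast

text \<open>As a default elimination rule \<open>reachableE\<close> turns every adjacency into an arc, on which the
  automation diverges.\<close>

declare reachableE [rule del]

text \<open>The five vertices induce a butterfly if \<open>c \<rightarrow> e\<close>, and a hammer otherwise.\<close>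

lemma (in graph) triangle_path:
  assumes free: "induced_free {butterfly, hammer} G"
    and edges: "a \<rightarrow> b" "a \<rightarrow> c" "b \<rightarrow> c" "c \<rightarrow> d" "d \<rightarrow> e"
    and "e \<noteq> c"
    and nonedges: "\<not> a \<rightarrow> d" "\<not> b \<rightarrow> d" "\<not> a \<rightarrow> e" "\<not> b \<rightarrow> e"
  shows False
proof -
  \<comment> \<open>Label 2 goes to \<open>c\<close>, the vertex shared by triangle and path, as in
    \<open>butterfly\<close> and \<open>hammer\<close>.\<close>
  define f where "f = nth [a, b, c, d, e]"
  define V :: "nat set" where "V = {0, 1, 2, 3, 4}"
  have f: "f 0 = a" "f (Suc 0) = b" "f 2 = c" "f 3 = d" "f 4 = e"
    by (simp_all add: f_def)
  \<comment> \<open>The adjacency pattern separates all pairs except \<open>c, e\<close>, whose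
    distinctness is assumed.\<close>
  have ne: "a \<noteq> b" "a \<noteq> c" "a \<noteq> d" "a \<noteq> e" "b \<noteq> c" "b \<noteq> d" "b \<noteq> e" "c \<noteq> d" "c \<noteq> e" "d \<noteq> e"
    using assms by (metis graph_symmetric adj_irrefl)+
  have inj: "inj_on f V"
    using ne by (auto simp: inj_on_def V_def f)
  have sub: "f ` V \<subseteq> verts G"
    using edges[THEN adj_verts] by (simp add: V_def f)
  have ind: "induced_subgraph (G \<restriction> f ` V) G"
    using sub by (rule induced_induce)
  have nonedges': "\<not> d \<rightarrow> a" "\<not> d \<rightarrow> b" "\<not> e \<rightarrow> a" "\<not> e \<rightarrow> b"
    using nonedges by (metis graph_symmetric)+
  note adj = edges edges[THEN graph_symmetric] nonedges nonedges' adj_irrefl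
  show False
  proof (cases "c \<rightarrow> e")
    case True
    have "digraph_iso (G \<restriction> f ` V) butterfly"
      unfolding butterfly_def V_def[symmetric]
    proof (rule digraph_iso_graph_of_edgesI[OF inj sub])
      have *: "\<forall>x\<in>V. \<forall>y\<in>V. f x \<rightarrow> f y \<longleftrightarrow>
        (x, y) \<in> {(0,1), (1,2), (0,2), (2,3), (3,4), (2,4)} \<union> {(0,1), (1,2), (0,2), (2,3), (3,4), (2,4)}\<inverse>"
        by (simp add: V_def f adj True graph_symmetric[OF True])
      show "f x \<rightarrow> f y \<longleftrightarrow>
        (x, y) \<in> {(0,1), (1,2), (0,2), (2,3), (3,4), (2,4)} \<union> {(0,1), (1,2), (0,2), (2,3), (3,4), (2,4)}\<inverse>"
        if "x \<in> V" "y \<in> V" for x y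
        using bspec[OF bspec[OF * that(1)] that(2)] .
    qed (simp add: V_def)
    with free ind show False
      unfolding induced_free_def by blast
  next
    case False
    then have "\<not> e \<rightarrow> c"
      by (metis graph_symmetric)
    have "digraph_iso (G \<restriction> f ` V) hammer"
      unfolding hammer_def V_def[symmetric]
    proof (rule digraph_iso_graph_of_edgesI[OF inj sub])
      have *: "\<forall>x\<in>V. \<forall>y\<in>V. f x \<rightarrow> f y \<longleftrightarrow>
        (x, y) \<in> {(0,1), (1,2), (0,2), (2,3), (3,4)} \<union> {(0,1), (1,2), (0,2), (2,3), (3,4)}\<inverse>"
        by (simp add: V_def f adj False \<open>\<not> e \<rightarrow> c\<close>)
      show "f x \<rightarrow> f y \<longleftrightarrow>
        (x, y) \<in> {(0,1), (1,2), (0,2), (2,3), (3,4)} \<union> {(0,1), (1,2), (0,2), (2,3), (3,4)}\<inverse>"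
        if "x \<in> V" "y \<in> V" for x y
        using bspec[OF bspec[OF * that(1)] that(2)] .
    qed (simp add: V_def)
    with free ind show False
      unfolding induced_free_def by blast
  qed
qed

text \<open>An induced subgraph of \<open>G \<restriction> W\<close> is induced in \<open>G\<close>.
  The premises of \<open>no\<close> force four distinct vertices: \<open>p = r\<close>, for
  instance, would give \<open>p \<rightarrow> s\<close>.\<close>

lemma (in graph) induced_two_K2_freeI:
  assumes W: "W \<subseteq> verts G"
    and no: "\<And>p q r s. \<lbrakk>p \<in> W; q \<in> W; r \<in> W; s \<in> W; p \<rightarrow> q; r \<rightarrow> s;
      \<not> p \<rightarrow> r; \<not> p \<rightarrow> s; \<not> q \<rightarrow> r; \<not> q \<rightarrow> s\<rbrakk> \<Longrightarrow> False"
  shows "induced_free {two_K2} (G \<restriction> W)"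
proof -
  have False if K: "induced_subgraph K (G \<restriction> W)" "digraph_iso K two_K2" for K
  proof -
    have K': "induced_subgraph K G" and vK: "verts K \<subseteq> W"
      using K(1) W wf_digraph by (auto simp: induced_subgraph_def subgraph_def compatible_def)
    show False
    proof (rule digraph_iso_graph_of_edgesD[OF K' K(2)[unfolded two_K2_def]])
      fix f assume img: "f ` {0, 1, 2, 3 :: nat} = verts K"
        and adj: "\<And>x y :: nat. \<lbrakk>x \<in> {0, 1, 2, 3}; y \<in> {0, 1, 2, 3}\<rbrakk> \<Longrightarrow>
          f x \<rightarrow> f y \<longleftrightarrow> (x, y) \<in> {(0, 1), (2, 3)} \<union> {(0, 1), (2, 3)}\<inverse>"
      have "f 0 \<in> W" "f 1 \<in> W" "f 2 \<in> W" "f 3 \<in> W"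
        using img vK by blast+
      then show False
        by (rule no) (simp_all add: adj)
    qed
  qed
  then show ?thesis
    unfolding induced_free_def by blast
qed

section \<open>Cliques, connectivity and counting\<close>

definition clique :: "('a,'b) pre_digraph \<Rightarrow> 'a set \<Rightarrow> bool" where
  "clique G S \<longleftrightarrow> S \<subseteq> verts G \<and> (\<forall>u\<in>S. \<forall>v\<in>S. u \<noteq> v \<longrightarrow> u \<rightarrow>\<^bsub>G\<^esub> v)"

lemma (in graph) graph_induce:
  assumes "S \<subseteq> verts G"
  shows "graph (G \<restriction> S)"
  using induced_graph_imp_graph digraphI_induced induced_induce[OF assms]
  by (metis digraph.graphI induced_graph_imp_symmetric sym_arcs)

lemma induce_adj_iff: "u \<rightarrow>\<^bsub>G \<restriction> S\<^esub> v \<longleftrightarrow> u \<rightarrow>\<^bsub>G\<^esub> v \<and> u \<in> S \<and> v \<in> S"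
  by (auto simp: arcs_ends_conv)

text \<open>A complete subgraph \<open>H\<close> yields the clique \<open>verts H\<close>, and a
  clique \<open>S\<close> the complete graph \<open>G \<restriction> S\<close>. Thus
  \<open>clique_number\<close> becomes a maximum over vertex sets.\<close>

lemma (in graph) clique_sizes: "{n. \<exists>H. subgraph H G \<and> K\<^bsub>n\<^esub> H} = card ` {S. clique G S}"
proof (intro equalityI subsetI)
  fix n assume "n \<in> {n. \<exists>H. subgraph H G \<and> K\<^bsub>n\<^esub> H}"
  then obtain H where H: "subgraph H G" "K\<^bsub>n\<^esub> H" by blast
  then have "arcs_ends H \<subseteq> arcs_ends G"
    by (auto simp: subgraph_def compatible_def arcs_ends_conv)
  with H have "clique G (verts H)"
    by (auto simp: clique_def complete_digraph_def subgraph_def)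
  with H(2) show "n \<in> card ` {S. clique G S}"
    by (auto simp: complete_digraph_def)
next
  fix n assume "n \<in> card ` {S. clique G S}"
  then obtain S where S: "clique G S" "n = card S" by blast
  then have sub: "S \<subseteq> verts G" by (simp add: clique_def)
  have "K\<^bsub>n\<^esub> (G \<restriction> S)"
    using S graph_induce[OF sub] adj_irrefl
    by (auto simp: complete_digraph_def induce_adj_iff clique_def)
  moreover have "subgraph (G \<restriction> S) G"
    using sub by (rule subgraph_induce_subgraphI)
  ultimately show "n \<in> {n. \<exists>H. subgraph H G \<and> K\<^bsub>n\<^esub> H}" by blast
qed

lemma (in graph) clique_finite: "finite {S. clique G S}"
  by (rule finite_subset[of _ "Pow (verts G)"]) (auto simp: clique_def)

lemma (in graph) clique_card_le: "clique G S \<Longrightarrow> card S \<le> clique_number G"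
  unfolding clique_number_def clique_sizes by (rule Max_ge) (auto simp: clique_finite)

lemma (in graph) clique_number_attained:
  obtains S where "clique G S" "card S = clique_number G"
proof -
  \<comment> \<open>The empty clique makes the set of sizes nonempty, so its maximum is
    attained.\<close>
  have "clique G {}" by (simp add: clique_def)
  then have "clique_number G \<in> card ` {S. clique G S}"
    unfolding clique_number_def clique_sizes by (intro Max_in) (auto simp: clique_finite)
  with that show thesis by auto
qed

text \<open>Induction along a walk from \<open>v\<close>; it later bounds the distance of all
  vertices from the clique.\<close>

lemma (in graph) connected_closed_superset:
  assumes "connected G" and "v \<in> verts G" "v \<in> D"
    and closed: "\<And>x w. \<lbrakk>x \<in> D; x \<rightarrow> w\<rbrakk> \<Longrightarrow> w \<in> D"
  shows "verts G \<subseteq> D"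
proof
  fix w assume "w \<in> verts G"
  with assms have "v \<rightarrow>\<^sup>*\<^bsub>mk_symmetric G\<^esub> w"
    by (auto simp: connected_def strongly_connected_def mk_symmetric_def)
  \<comment> \<open>\<open>connected\<close> speaks of the symmetric closure, which has the same
    reachability because the arcs of \<open>G\<close> are symmetric already.\<close>
  then have "v \<rightarrow>\<^sup>* w"
    using reachable_mk_symmetric_eq[OF sym_arcs] by simp
  then show "w \<in> D"
    by (induct rule: reachable_induct) (use assms in auto)
qed

lemma chromatic_number_le: "proper_coloring G k c \<Longrightarrow> chromatic_number G \<le> k"
  unfolding chromatic_number_def by (blast intro: Least_le)

text \<open>Pascal's rule; this is the number of colours available.\<close>

lemma card_small_subsets:
  assumes "finite K"
  shows "card {P. P \<subseteq> K \<and> (card P = 1 \<or> card P = 2)} = (card K + 1) choose 2"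
proof -
  have "{P. P \<subseteq> K \<and> (card P = 1 \<or> card P = 2)} =
    {P. P \<subseteq> K \<and> card P = 1} \<union> {P. P \<subseteq> K \<and> card P = 2}"
    by auto
  then have "card {P. P \<subseteq> K \<and> (card P = 1 \<or> card P = 2)} = (card K choose 1) + (card K choose 2)"
    using assms by (simp add: card_Un_disjoint disjoint_iff n_subsets)
  then show ?thesis
    by (simp add: numeral_2_eq_2)
qed

section \<open>A maximum clique with at least three vertices\<close>

locale butterfly_hammer_free_max_clique = graph +
  fixes K
  assumes conn: "connected G"
    and free: "induced_free {butterfly, hammer} G"
    and K_clique: "clique G K"
    and K_card: "card K = clique_number G"
    and K_ge_3: "3 \<le> card K"
begin

text \<open>The set \<open>M y\<close> of the overview. Adjacency is irreflexive, so a vertex of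
  \<open>K\<close> misses itself.\<close>

definition nonnbrs :: "'a \<Rightarrow> 'a set" where
  "nonnbrs y = {v \<in> K. \<not> y \<rightarrow> v}"

lemma K_verts: "K \<subseteq> verts G"
  using K_clique by (simp add: clique_def)

lemma K_finite: "finite K"
  using K_verts finite_verts by (rule finite_subset)

lemma K_adj: "\<lbrakk>u \<in> K; v \<in> K; u \<noteq> v\<rbrakk> \<Longrightarrow> u \<rightarrow> v"
  using K_clique by (simp add: clique_def)

lemma nonnbrs_subset: "nonnbrs y \<subseteq> K"
  by (auto simp: nonnbrs_def)

lemma finite_nonnbrs: "finite (nonnbrs y)"
  using nonnbrs_subset K_finite by (rule finite_subset)

lemma nonnbrs_K: "v \<in> K \<Longrightarrow> nonnbrs v = {v}"
  using K_adj adj_irrefl by (auto simp: nonnbrs_def)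

text \<open>Otherwise \<open>insert y K\<close> would be a larger clique.\<close>

lemma nonnbrs_nonempty:
  assumes "y \<in> verts G"
  shows "nonnbrs y \<noteq> {}"
proof
  assume "nonnbrs y = {}"
  then have adj: "y \<rightarrow> v" if "v \<in> K" for v
    using that by (auto simp: nonnbrs_def)
  then have "y \<notin> K" using adj_irrefl by blast
  have "clique G (insert y K)"
    using assms K_clique adj by (auto simp: adj_commute clique_def)
  then show False
    using clique_card_le[of "insert y K"] \<open>y \<notin> K\<close> K_finite K_card by simp
qed

text \<open>Otherwise exchanging \<open>v\<close> for both \<open>y\<close> and \<open>z\<close>
  would turn \<open>K\<close> into a larger clique.\<close>

lemma nonnbrs_eq_singleton_nonadj:
  assumes y: "nonnbrs y = {v}" and z: "nonnbrs z = {v}"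
  shows "\<not> y \<rightarrow> z"
proof
  assume yz: "y \<rightarrow> z"
  let ?S = "insert y (insert z (K - {v}))"
  have v: "v \<in> K" using y nonnbrs_subset by blast
  have adj: "y \<rightarrow> u" "z \<rightarrow> u" if "u \<in> K - {v}" for u
    using that y z by (auto simp: nonnbrs_def)
  then have "y \<notin> K - {v}" "z \<notin> K - {v}" using adj_irrefl by blast+
  moreover have "y \<noteq> z" using yz adj_irrefl by blast
  ultimately have "card ?S = Suc (card K)"
    using v K_finite card_Suc_Diff1[OF K_finite v] by simp
  moreover have "clique G ?S"
    using adj yz K_clique adj_verts[OF yz] by (auto simp: adj_commute clique_def)
  ultimately show False
    using clique_card_le[of ?S] K_card by simp
qed

section \<open>Vertices without neighbours in the clique\<close>

text \<open>If \<open>i \<noteq> j\<close> and \<open>c\<close> is a neighbour of \<open>z\<close>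
  in \<open>K\<close>, the triangle \<open>i, j, c\<close> with the path \<open>c, z, x\<close> is
  forbidden: \<open>x\<close> has no neighbour in \<open>K\<close>.\<close>

lemma second_layer_nbr:
  assumes "nonnbrs z \<noteq> K" "nonnbrs x = K" "z \<rightarrow> x"
    and i: "i \<in> nonnbrs z" and j: "j \<in> nonnbrs z"
  shows "i = j"
proof (rule ccontr)
  assume "i \<noteq> j"
  from \<open>nonnbrs z \<noteq> K\<close> obtain c where c: "c \<in> K" "z \<rightarrow> c"
    by (auto simp: nonnbrs_def)
  have "i \<in> K" "j \<in> K" "\<not> z \<rightarrow> i" "\<not> z \<rightarrow> j"
    using i j by (auto simp: nonnbrs_def)
  note ij = this
  have "c \<noteq> i" "c \<noteq> j"
    using c ij by auto
  have no: "\<not> v \<rightarrow> x" if "v \<in> K" for v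
    using that assms(2) by (auto simp: adj_commute nonnbrs_def)
  show False
  proof (rule triangle_path[OF free, of i j c z x])
    show "i \<rightarrow> j" "i \<rightarrow> c" "j \<rightarrow> c"
      using ij c K_adj \<open>i \<noteq> j\<close> \<open>c \<noteq> i\<close> \<open>c \<noteq> j\<close> by auto
    with no[OF ij(1)] show "x \<noteq> c" by auto
    show "c \<rightarrow> z" "\<not> i \<rightarrow> z" "\<not> j \<rightarrow> z"
      using c ij by (auto simp: adj_commute)
  qed (use no ij \<open>z \<rightarrow> x\<close> in simp_all)
qed

lemma card_nonnbrs_second_layer_nbr:
  assumes "nonnbrs z \<noteq> K" "nonnbrs x = K" "z \<rightarrow> x"
  shows "card (nonnbrs z) \<le> 1"
proof -
  have "\<forall>i\<in>nonnbrs z. \<forall>j\<in>nonnbrs z. i = j"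
    by (intro ballI) (rule second_layer_nbr[OF assms])
  then have "card (nonnbrs z) \<le> Suc 0"
    by (rule iffD2[OF card_le_Suc0_iff_eq[OF finite_nonnbrs]])
  then show ?thesis
    by (simp only: One_nat_def)
qed

text \<open>By the previous bound \<open>z\<close> is joined to two vertices \<open>c, d\<close> of
  \<open>K\<close>; the triangle \<open>c, d, z\<close> with the path \<open>z, x, w\<close> is
  forbidden.\<close>

lemma second_layer_nbr_edge:
  assumes "nonnbrs z \<noteq> K" "nonnbrs x = K" "nonnbrs w = K" "z \<rightarrow> x" "x \<rightarrow> w"
  shows False
proof -
  have "card (nonnbrs z) \<le> 1"
    using assms by (intro card_nonnbrs_second_layer_nbr)
  then have "2 \<le> card (K - nonnbrs z)"
    using K_ge_3 by (simp add: card_Diff_subset finite_nonnbrs nonnbrs_subset)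
  then have "\<not> card (K - nonnbrs z) \<le> Suc 0"
    by simp
  then obtain c d where cd: "c \<in> K - nonnbrs z" "d \<in> K - nonnbrs z" "c \<noteq> d"
    using card_le_Suc0_iff_eq[of "K - nonnbrs z"] K_finite by auto
  have no: "\<not> v \<rightarrow> x" "\<not> v \<rightarrow> w" if "v \<in> K" for v
    using that assms(2,3) by (auto simp: adj_commute nonnbrs_def)
  show False
  proof (rule triangle_path[OF free, of c d z x w])
    show "c \<rightarrow> d" "c \<rightarrow> z" "d \<rightarrow> z"
      using cd K_adj by (auto simp: adj_commute nonnbrs_def)
    show "w \<noteq> z" using assms by auto
  qed (use no cd assms(4,5) in simp_all)
qed

text \<open>A walk starting in \<open>K\<close> never gets further than distance two: leaving a
  vertex \<open>x\<close> at distance two for a \<open>w\<close> without neighbours in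
  \<open>K\<close> contradicts \<open>second_layer_nbr_edge\<close>.\<close>

lemma within_distance_2:
  assumes "x \<in> verts G" "nonnbrs x = K"
  obtains z where "nonnbrs z \<noteq> K" "z \<rightarrow> x"
proof -
  let ?D = "{x \<in> verts G. nonnbrs x = K \<longrightarrow> (\<exists>z. nonnbrs z \<noteq> K \<and> z \<rightarrow> x)}"
  obtain v where v: "v \<in> K"
    using K_ge_3 by fastforce
  have "nonnbrs v \<noteq> K"
    using nonnbrs_K[OF v] K_ge_3 by auto
  then have "v \<in> ?D" "v \<in> verts G"
    using v K_verts by auto
  have "w \<in> ?D" if x: "x \<in> ?D" "x \<rightarrow> w" for x w
  proof (cases "nonnbrs x = K")
    case True
    with x obtain z where "nonnbrs z \<noteq> K" "z \<rightarrow> x" by auto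
    then have "nonnbrs w \<noteq> K"
      using second_layer_nbr_edge True x(2) by metis
    with adj_verts[OF x(2)] show ?thesis by simp
  next
    case False
    with x(2) adj_verts[OF x(2)] show ?thesis by auto
  qed
  with conn \<open>v \<in> verts G\<close> \<open>v \<in> ?D\<close> have "verts G \<subseteq> ?D"
    by (rule connected_closed_superset)
  with assms have "\<exists>z. nonnbrs z \<noteq> K \<and> z \<rightarrow> x" by blast
  with that show thesis by blast
qed

text \<open>Both the three independent parts and the two-element colours rest on this.\<close>

lemma common_nonnbrs_nonadj:
  assumes "i \<noteq> j" "{i, j} \<subseteq> nonnbrs y" "{i, j} \<subseteq> nonnbrs z"
  shows "\<not> y \<rightarrow> z"
proof
  assume yz: "y \<rightarrow> z"
  have K: "i \<in> K" "j \<in> K" and non: "\<not> y \<rightarrow> i" "\<not> y \<rightarrow> j" "\<not> z \<rightarrow> i" "\<not> z \<rightarrow> j"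
    using assms by (auto simp: nonnbrs_def)
  \<comment> \<open>A vertex of \<open>K\<close> misses only itself, hence not both \<open>i\<close>
    and \<open>j\<close>.\<close>
  then have "y \<notin> K" "z \<notin> K"
    using K_adj \<open>i \<noteq> j\<close> by blast+
  \<comment> \<open>The triangle \<open>i, j, c\<close> with the path \<open>c, u, w\<close>; either
    end of the edge may play the role of \<open>u\<close>.\<close>
  have no: False if "c \<in> K" "u \<rightarrow> c" "u \<rightarrow> w" "w \<notin> K" "\<not> u \<rightarrow> i" "\<not> u \<rightarrow> j" "\<not> w \<rightarrow> i" "\<not> w \<rightarrow> j"
    for c u w
  proof (rule triangle_path[OF free, of i j c u w])
    have "c \<noteq> i" "c \<noteq> j" using that by auto
    then show "i \<rightarrow> j" "i \<rightarrow> c" "j \<rightarrow> c"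
      using K K_adj \<open>c \<in> K\<close> \<open>i \<noteq> j\<close> by auto
    show "w \<noteq> c" using that by auto
  qed (use that graph_symmetric in blast)+
  show False
  proof (cases "nonnbrs y = K \<and> nonnbrs z = K")
    case True
    obtain x where "nonnbrs x \<noteq> K" "x \<rightarrow> y"
      using within_distance_2[of y] True adj_verts[OF yz] by blast
    then show False
      using second_layer_nbr_edge True yz by blast
  next
    case False
    then obtain c where "c \<in> K" "y \<rightarrow> c \<or> z \<rightarrow> c"
      by (auto simp: nonnbrs_def)
    then show False
      using no[of c y z] no[of c z y] non yz graph_symmetric[OF yz] \<open>y \<notin> K\<close> \<open>z \<notin> K\<close> by auto
  qed
qed

section \<open>Vertices missing at most one corner of a triangle\<close>

text \<open>A common neighbour \<open>i \<in> T\<close> of \<open>p, q\<close> is adjacent to neither \<open>r\<close> nor \<open>s\<close>, so \<open>r, s\<close> are joined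
  to all of \<open>T - {i}\<close>, where \<open>p\<close> has a neighbour too: a common neighbour of \<open>r, s, p\<close>.\<close>

lemma two_K2_free_over_triangle:
  assumes T: "card T = 3"
    and dense: "\<And>y. y \<in> {p, q, r, s} \<Longrightarrow> card {v \<in> T. \<not> y \<rightarrow> v} \<le> 1"
    and edges: "p \<rightarrow> q" "r \<rightarrow> s"
    and nonedges: "\<not> p \<rightarrow> r" "\<not> p \<rightarrow> s" "\<not> q \<rightarrow> r" "\<not> q \<rightarrow> s"
  shows False
proof -
  have "finite T" using T card.infinite by fastforce
  have miss: "u = v" if "y \<in> {p, q, r, s}" "u \<in> T" "v \<in> T" "\<not> y \<rightarrow> u" "\<not> y \<rightarrow> v" for y u v
    using dense[OF that(1)] that \<open>finite T\<close> by (simp add: card_le_Suc0_iff_eq)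
  \<comment> \<open>The triangle \<open>u, w, c\<close> with the path \<open>c, x, t\<close>, for an
    edge \<open>u w\<close>, an edge \<open>x t\<close> with no adjacency between them, and a common
    neighbour \<open>c\<close> of \<open>u, w, x\<close>.\<close>
  have no: False if "u \<rightarrow> c" "w \<rightarrow> c" "u \<rightarrow> w" "x \<rightarrow> c" "x \<rightarrow> t" "\<not> u \<rightarrow> x" "\<not> u \<rightarrow> t" "\<not> w \<rightarrow> x"
    "\<not> w \<rightarrow> t" for c u w x t
    using triangle_path[OF free \<open>u \<rightarrow> w\<close> \<open>u \<rightarrow> c\<close> \<open>w \<rightarrow> c\<close> graph_symmetric[OF \<open>x \<rightarrow> c\<close>] \<open>x \<rightarrow> t\<close>] that by auto
  \<comment> \<open>Each of \<open>p, q\<close> misses at most one of the three vertices of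
    \<open>T\<close>, so a common neighbour is left. The same count, with \<open>i\<close> excluded,
    later yields \<open>j\<close>.\<close>
  have "card ({v \<in> T. \<not> p \<rightarrow> v} \<union> {v \<in> T. \<not> q \<rightarrow> v}) < card T"
    using card_Un_le[of "{v \<in> T. \<not> p \<rightarrow> v}" "{v \<in> T. \<not> q \<rightarrow> v}"] dense[of p] dense[of q] T by simp
  then have "{v \<in> T. \<not> p \<rightarrow> v} \<union> {v \<in> T. \<not> q \<rightarrow> v} \<noteq> T" by auto
  then obtain i where i: "i \<in> T" "p \<rightarrow> i" "q \<rightarrow> i" by blast
  have r: "\<not> r \<rightarrow> i" and s: "\<not> s \<rightarrow> i"
    using no[of p i q r s] no[of p i q s r] i edges graph_symmetric[OF edges(2)] nonedges by auto
  have "card ({v \<in> T. \<not> p \<rightarrow> v} \<union> {i}) < card T"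
    using card_Un_le[of "{v \<in> T. \<not> p \<rightarrow> v}" "{i}"] dense[of p] T by simp
  then have "{v \<in> T. \<not> p \<rightarrow> v} \<union> {i} \<noteq> T" by auto
  then obtain j where j: "j \<in> T" "p \<rightarrow> j" "j \<noteq> i"
    using i by blast
  then have "r \<rightarrow> j" "s \<rightarrow> j"
    using miss[of r i j] miss[of s i j] r s i by auto
  moreover have "\<not> r \<rightarrow> p" "\<not> r \<rightarrow> q" "\<not> s \<rightarrow> p" "\<not> s \<rightarrow> q"
    using nonedges graph_symmetric by blast+
  ultimately show False
    using no[of r j s p q] j edges by auto
qed

lemma induced_two_K2_free_off_triangle:
  assumes "T \<subseteq> K" "card T = 3"
  shows "induced_free {two_K2} (G \<restriction> {y \<in> verts G. card (nonnbrs y \<inter> T) \<le> 1})"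
proof (rule induced_two_K2_freeI)
  have "nonnbrs y \<inter> T = {v \<in> T. \<not> y \<rightarrow> v}" for y
    using assms(1) by (auto simp: nonnbrs_def)
  then show False
    if "p \<in> {y \<in> verts G. card (nonnbrs y \<inter> T) \<le> 1}" "q \<in> {y \<in> verts G. card (nonnbrs y \<inter> T) \<le> 1}"
      "r \<in> {y \<in> verts G. card (nonnbrs y \<inter> T) \<le> 1}" "s \<in> {y \<in> verts G. card (nonnbrs y \<inter> T) \<le> 1}"
      "p \<rightarrow> q" "r \<rightarrow> s" "\<not> p \<rightarrow> r" "\<not> p \<rightarrow> s" "\<not> q \<rightarrow> r" "\<not> q \<rightarrow> s" for p q r s
    using that two_K2_free_over_triangle[OF assms(2), of p q r s] by auto
qed auto

lemma independent_set_common_nonnbrs: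
  assumes "i \<noteq> j" and S: "S \<subseteq> {y \<in> verts G. {i, j} \<subseteq> nonnbrs y}"
  shows "independent_set G S"
  unfolding independent_set_def
proof (intro conjI ballI)
  show "S \<subseteq> verts G" using S by blast
next
  fix u v assume "u \<in> S" "v \<in> S"
  with S have "{i, j} \<subseteq> nonnbrs u" "{i, j} \<subseteq> nonnbrs v" by blast+
  with \<open>i \<noteq> j\<close> show "\<not> u \<rightarrow> v" by (rule common_nonnbrs_nonadj)
qed

section \<open>The dominating part and the partition\<close>

text \<open>This becomes the part \<open>X 1\<close>.\<close>

definition core :: "'a set" where
  "core = {y \<in> verts G. card (nonnbrs y) = 1}"

lemma K_subset_core: "K \<subseteq> core"
  using K_verts nonnbrs_K by (auto simp: core_def)

text \<open>Vertices with a neighbour in \<open>K\<close> are dominated by \<open>K\<close> itself.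
  Any other vertex has a neighbour \<open>z\<close> that is joined to \<open>K\<close>; such a
  \<open>z\<close> misses at most one vertex of \<open>K\<close>, and exactly one by
  maximality.\<close>

lemma dominating_core: "dominating_set G core"
  unfolding dominating_set_def
proof (intro conjI ballI)
  fix x assume x: "x \<in> verts G - core"
  show "\<exists>u\<in>core. x \<rightarrow> u"
  proof (cases "nonnbrs x = K")
    case True
    then obtain z where z: "nonnbrs z \<noteq> K" "z \<rightarrow> x"
      using x within_distance_2[of x] by blast
    then have "card (nonnbrs z) \<le> 1"
      using card_nonnbrs_second_layer_nbr[OF z(1) True z(2)] by simp
    moreover have "card (nonnbrs z) \<noteq> 0"
      using nonnbrs_nonempty[of z] adj_verts[OF z(2)] by (simp add: finite_nonnbrs)
    ultimately have "z \<in> core"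
      using adj_verts[OF z(2)] by (simp add: core_def)
    then show ?thesis using z graph_symmetric by blast
  next
    case False
    then show ?thesis using K_subset_core by (auto simp: nonnbrs_def)
  qed
qed (auto simp: core_def)

text \<open>Vertices are grouped by the single vertex of \<open>K\<close> that they miss, which
  gives one independent part per vertex of \<open>K\<close>.\<close>

lemma k_partite_core: "k_partite (clique_number G) (G \<restriction> core)"
proof -
  obtain h where h: "bij_betw h {..<card K} K"
    using ex_bij_betw_nat_finite[OF K_finite] by (auto simp: atLeast0LessThan)
  define P where "P i = {y \<in> verts G. nonnbrs y = {h i}}" for i
  have "core = (\<Union>i<card K. P i)"
  proof (intro equalityI subsetI)
    fix y assume "y \<in> core"
    then obtain v where y: "nonnbrs y = {v}" "y \<in> verts G"
      by (auto simp: core_def card_1_singleton_iff)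
    then have "v \<in> h ` {..<card K}"
      using nonnbrs_subset[of y] h by (simp add: bij_betw_def)
    with y show "y \<in> (\<Union>i<card K. P i)" by (auto simp: P_def)
  qed (auto simp: P_def core_def)
  moreover have "disjoint_family_on P {..<card K}"
    using h by (fastforce simp: disjoint_family_on_def P_def bij_betw_def inj_on_def)
  moreover have "independent_set (G \<restriction> core) (P i)" for i
    using nonnbrs_eq_singleton_nonadj by (auto simp: independent_set_def P_def core_def induce_adj_iff)
  ultimately show ?thesis
    unfolding k_partite_def K_card[symmetric] by auto
qed

text \<open>\<open>K\<close> lies inside \<open>core\<close>, and cliques of an induced subgraph are
  cliques of \<open>G\<close>.\<close>

lemma clique_number_core: "clique_number (G \<restriction> core) = clique_number G"
proof (rule antisym)
  have core: "core \<subseteq> verts G" by (auto simp: core_def)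
  interpret core: graph "G \<restriction> core" by (rule graph_induce[OF core])
  obtain S where "clique (G \<restriction> core) S" "card S = clique_number (G \<restriction> core)"
    by (rule core.clique_number_attained)
  moreover then have "clique G S"
    using core by (auto simp: clique_def induce_adj_iff)
  ultimately show "clique_number (G \<restriction> core) \<le> clique_number G"
    using clique_card_le by metis
  have "clique (G \<restriction> core) K"
    using K_subset_core K_adj by (auto simp: clique_def induce_adj_iff)
  then show "clique_number G \<le> clique_number (G \<restriction> core)"
    using core.clique_card_le K_card by metis
qed

lemma partition:
  "\<exists>X :: nat \<Rightarrow> 'a set.
    verts G = X 1 \<union> X 2 \<union> X 3 \<union> X 4 \<union> X 5 \<and>
    disjoint_family_on X {1..5} \<and>
    dominating_set G (X 1) \<and>
    k_partite (clique_number G) (G \<restriction> X 1) \<and>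
    clique_number (G \<restriction> X 1) = clique_number G \<and>
    independent_set G (X 2) \<and> independent_set G (X 3) \<and> independent_set G (X 4) \<and>
    induced_free {two_K2} (G \<restriction> (X 1 \<union> X 5))"
proof -
  obtain T where T: "T \<subseteq> K" "card T = 3"
    using K_ge_3 obtain_subset_with_card_n by metis
  then obtain i j l where ijl: "T = {i, j, l}" "i \<noteq> j" "i \<noteq> l" "j \<noteq> l"
    by (auto simp: card_3_iff)
  define W where "W = {y \<in> verts G. card (nonnbrs y \<inter> T) \<le> 1}"
  define C where "C u v = {y \<in> verts G. {u, v} \<subseteq> nonnbrs y}" for u v
  \<comment> \<open>A vertex missing all of \<open>T\<close> lies in all three sets
    \<open>C\<close>, hence the differences. \<open>X 1\<close> and \<open>X 5\<close> together make
    up \<open>W\<close>.\<close>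
  define X :: "nat \<Rightarrow> 'a set" where "X = (\<lambda>_. {})(1 := core, 2 := C i j, 3 := C i l - C i j,
    4 := C j l - C i l - C i j, 5 := W - core)"
  have X: "X 1 = core" "X 2 = C i j" "X 3 = C i l - C i j" "X 4 = C j l - C i l - C i j" "X 5 = W - core"
    by (simp_all add: X_def)
  have core_W: "core \<subseteq> W"
  proof
    fix y assume "y \<in> core"
    then show "y \<in> W"
      using card_mono[OF finite_nonnbrs Int_lower1, of y T] by (simp add: core_def W_def)
  qed
  have W: "y \<notin> W" if "y \<in> C u v" "u \<in> T" "v \<in> T" "u \<noteq> v" for y u v
  proof -
    have "card {u, v} \<le> card (nonnbrs y \<inter> T)"
      using that finite_nonnbrs by (intro card_mono) (auto simp: C_def)
    with that show ?thesis by (simp add: W_def)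
  qed
  \<comment> \<open>Two missed elements of \<open>T\<close> form one of its three pairs.\<close>
  have C: "y \<in> C i j \<union> C i l \<union> C j l" if "y \<in> verts G" "y \<notin> W" for y
  proof -
    have "\<not> card (nonnbrs y \<inter> T) \<le> Suc 0"
      using that by (simp add: W_def)
    then obtain u v where "u \<in> nonnbrs y \<inter> T" "v \<in> nonnbrs y \<inter> T" "u \<noteq> v"
      using card_le_Suc0_iff_eq[of "nonnbrs y \<inter> T"] finite_nonnbrs by auto
    then show ?thesis
      using that ijl by (auto simp: C_def)
  qed
  have indep: "independent_set G S" if "u \<noteq> v" "S \<subseteq> C u v" for S u v
    using that unfolding C_def by (rule independent_set_common_nonnbrs)
  have WC: "W \<inter> C i j = {}" "W \<inter> C i l = {}" "W \<inter> C j l = {}"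
    using W ijl by blast+
  have "W \<subseteq> verts G" "C u v \<subseteq> verts G" for u v
    by (auto simp: W_def C_def)
  then have "verts G = X 1 \<union> X 2 \<union> X 3 \<union> X 4 \<union> X 5"
    unfolding X using C core_W by blast
  moreover have "{1..5} = {1, 2, 3, 4, 5 :: nat}" by auto
  then have "disjoint_family_on X {1..5}"
    using core_W WC by (auto simp: disjoint_family_on_def X[unfolded One_nat_def])
  moreover have "independent_set G (X 2)"
    unfolding X by (rule indep[OF ijl(2)]) blast
  moreover have "independent_set G (X 3)"
    unfolding X by (rule indep[OF ijl(3)]) blast
  moreover have "independent_set G (X 4)"
    unfolding X by (rule indep[OF ijl(4)]) blast
  moreover have "induced_free {two_K2} (G \<restriction> (X 1 \<union> X 5))"
    using induced_two_K2_free_off_triangle[OF T] core_W unfolding X W_def[symmetric]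
    by (simp add: Un_absorb1)
  ultimately show ?thesis
    using dominating_core k_partite_core clique_number_core X(1) by (intro exI[of _ X]) simp
qed

section \<open>The colouring\<close>

lemma chromatic_bound: "chromatic_number G \<le> (clique_number G + 1) choose 2"
proof -
  define Q where "Q = {P. P \<subseteq> K \<and> (card P = 1 \<or> card P = 2)}"
  have "finite Q" using K_finite by (simp add: Q_def)
  then obtain h where h: "bij_betw h Q {0..<card Q}"
    using ex_bij_betw_finite_nat by blast
  \<comment> \<open>A one-element colour must be all of \<open>nonnbrs y\<close>: sharing just one
    missed vertex does not prevent adjacency.\<close>
  have "\<exists>P. P \<in> Q \<and> P \<subseteq> nonnbrs y \<and> (card P = 2 \<or> P = nonnbrs y)" if "y \<in> verts G" for y
  proof (cases "2 \<le> card (nonnbrs y)")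
    case True
    then obtain P where "P \<subseteq> nonnbrs y" "card P = 2"
      using obtain_subset_with_card_n by metis
    then show ?thesis using nonnbrs_subset[of y] by (auto simp: Q_def)
  next
    case False
    moreover have "card (nonnbrs y) \<noteq> 0"
      using nonnbrs_nonempty[OF that] by (simp add: finite_nonnbrs)
    ultimately have "card (nonnbrs y) = 1" by linarith
    then show ?thesis using nonnbrs_subset[of y] by (auto simp: Q_def)
  qed
  then obtain p where p: "\<And>y. y \<in> verts G \<Longrightarrow>
      p y \<in> Q \<and> p y \<subseteq> nonnbrs y \<and> (card (p y) = 2 \<or> p y = nonnbrs y)"
    by metis
  have "proper_coloring G (card Q) (h \<circ> p)"
    unfolding proper_coloring_def
  proof (intro conjI ballI impI)
    fix y assume "y \<in> verts G"
    then show "(h \<circ> p) y < card Q"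
      using p h by (auto simp: bij_betw_def)
  next
    fix y z assume yz: "y \<in> verts G" "z \<in> verts G" "y \<rightarrow> z"
    show "(h \<circ> p) y \<noteq> (h \<circ> p) z"
    proof
      assume "(h \<circ> p) y = (h \<circ> p) z"
      then have eq: "p y = p z"
        using p yz h by (auto simp: bij_betw_def inj_on_def)
      show False
      \<comment> \<open>Equal colours mean either a common missed pair or the same single missed
        vertex; both exclude adjacency.\<close>
      proof (cases "card (p y) = 2")
        case True
        then obtain i j where "p y = {i, j}" "i \<noteq> j" by (auto simp: card_2_iff)
        then show False
          using common_nonnbrs_nonadj[of i j y z] p[OF yz(1)] p[OF yz(2)] yz(3) eq by auto
      next
        case False
        then have "card (p y) = 1" "p y = nonnbrs y" "p y = nonnbrs z"
          using p[OF yz(1)] p[OF yz(2)] eq by (auto simp: Q_def)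
        then show False
          using nonnbrs_eq_singleton_nonadj[of y _ z] yz(3) by (metis card_1_singletonE)
      qed
    qed
  qed
  then have "chromatic_number G \<le> card Q" by (rule chromatic_number_le)
  then show ?thesis
    using card_small_subsets[OF K_finite] K_card by (simp add: Q_def)
qed

end

section \<open>The theorem, with the edgeless case\<close>

theorem theorem3p2:
  fixes G :: "('a,'b) pre_digraph"
  assumes "graph G"
    and "connected G"
    and "induced_free {butterfly, hammer} G"
    and "clique_number G \<noteq> 2"
  shows "(\<exists>X :: nat \<Rightarrow> 'a set.
            verts G = X 1 \<union> X 2 \<union> X 3 \<union> X 4 \<union> X 5 \<and>
            disjoint_family_on X {1..5} \<and>
            dominating_set G (X 1) \<and>
            k_partite (clique_number G) (G \<restriction> X 1) \<and>
            clique_number (G \<restriction> X 1) = clique_number G \<and>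
            independent_set G (X 2) \<and> independent_set G (X 3) \<and> independent_set G (X 4) \<and>
            induced_free {two_K2} (G \<restriction> (X 1 \<union> X 5)))
         \<and> chromatic_number G \<le> (clique_number G + 1) choose 2"
proof -
  interpret graph G by fact
  obtain K where K: "clique G K" "card K = clique_number G"
    by (rule clique_number_attained)
  show ?thesis
  proof (cases "3 \<le> clique_number G")
    case True
    interpret butterfly_hammer_free_max_clique G K
      by unfold_locales (use assms K True in auto)
    show ?thesis
      using partition chromatic_bound by blast
  next
    case False
    \<comment> \<open>A connected graph has a vertex, so the clique number is 1 here and
      \<open>G\<close> has no edges.\<close>
    have "verts G \<noteq> {}"
      using assms(2) by (auto simp: connected_def strongly_connected_def)
    then obtain v where v: "v \<in> verts G" by blast
    then have "clique G {v}" by (simp add: clique_def)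
    then have one: "clique_number G = 1"
      using clique_card_le[of "{v}"] False assms(4) by simp
    have no_edge: "\<not> x \<rightarrow>\<^bsub>G\<^esub> y" for x y
    proof
      assume xy: "x \<rightarrow>\<^bsub>G\<^esub> y"
      then have "clique G {x, y}"
        using xy adj_verts[OF xy] by (auto simp: adj_commute clique_def)
      moreover have "x \<noteq> y"
        using xy adj_irrefl by blast
      ultimately show False
        using clique_card_le[of "{x, y}"] one by simp
    qed
    have induce: "G \<restriction> verts G = G"
      by (rule induce_eq_iff_induced) (rule induced_subgraph_refl)
    \<comment> \<open>Without edges, \<open>verts G\<close> alone serves as \<open>X 1\<close>, and
      one colour meets the bound, which is 1.\<close>
    define X :: "nat \<Rightarrow> 'a set" where "X = (\<lambda>_. {})(1 := verts G)"
    have X: "X 1 = verts G" "X 2 = {}" "X 3 = {}" "X 4 = {}" "X 5 = {}"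
      by (simp_all add: X_def)
    have "disjoint_family_on X {1..5}"
      by (auto simp: disjoint_family_on_def X_def)
    moreover have "dominating_set G (verts G)"
      by (simp add: dominating_set_def)
    moreover have "k_partite 1 G"
      using no_edge by (auto simp: k_partite_def independent_set_def disjoint_family_on_def
          intro!: exI[of _ "\<lambda>_. verts G"])
    moreover have "independent_set G {}"
      by (simp add: independent_set_def)
    moreover have "induced_free {two_K2} (G \<restriction> verts G)"
      using no_edge by (intro induced_two_K2_freeI) auto
    moreover have "proper_coloring G 1 (\<lambda>_. 0)"
      using no_edge by (simp add: proper_coloring_def)
    then have "chromatic_number G \<le> 1"
      by (rule chromatic_number_le)
    then have "chromatic_number G \<le> (1 + 1) choose 2"
      by (simp add: numeral_2_eq_2)
    ultimately show ?thesis
      unfolding one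
      by (intro conjI exI[of _ X]) (simp_all add: X[unfolded One_nat_def] induce one)
  qed
qed

end
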